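(* Any (possibly randomized) $(1+\epsilon)$-approximation algorithm for the shortest path problem has Lipschitz constant $\Omega(\epsilon^{-1})$; that is, there is an input graph (with source and target) on which its Lipschitz constant is at least $c/\epsilon$ for an absolute constant $c>0$.
   Context: Shortest path problem: given an undirected graph $G=(V,E)$ (parallel edges allowed), $s,t\in V$ and $w\in\mathbb{R}_{\geq0}^E$, output an $s$-$t$ walk $P$ (multiset of edges) of small length $\sum_{e\in P}w(e)$. A randomized algorithm is a $(1+\epsilon)$-approximation if the expected length of its output is at most $(1+\epsilon)$ times the minimum length of an $s$-$t$ path. For walks $P,P'$, $d_w((P,w),(P',w'))=\|\sum_{e\in P}w(e)\mathbf{1}_e-\sum_{e\in P'}w'(e)\mathbf{1}_e\|_1$ (with multiplicity); $\mathrm{EM}_\mathrm{w}$ of two output distributions is the minimum over couplings of the expected $d_w$; the Lipschitz constant of $\mathcal{A}$ on $G$ is $\sup_{w\neq w'}\mathrm{EM}_\mathrm{w}((\mathcal{A}(G,w),w),(\mathcal{A}(G,w'),w'))/\|w-w'\|_1$. *)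

theory Defs
  imports "HOL-Probability.Probability"
begin

record ('v, 'e) mgraph =
  verts :: "'v set"
  edges :: "'e set"
  ends :: "'e \<Rightarrow> 'v set"

text \<open>
  Finite undirected graphs; parallel edges are allowed, loops are not. Extensionality of the
  incidence map makes \<^term>\<open>G\<close> carry no information about labels that are not edges.
\<close>

definition multigraph :: "('v, 'e) mgraph \<Rightarrow> bool" where
  "multigraph G \<longleftrightarrow> finite (verts G) \<and> finite (edges G) \<and>
     ends G \<in> edges G \<rightarrow>\<^sub>E {{u, v} | u v. u \<in> verts G \<and> v \<in> verts G \<and> u \<noteq> v}"

definition is_walk :: "('v, 'e) mgraph \<Rightarrow> 'v \<Rightarrow> 'v \<Rightarrow> 'v list \<Rightarrow> 'e list \<Rightarrow> bool" where
  "is_walk G s t vs es \<longleftrightarrow>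
     length vs = Suc (length es) \<and> hd vs = s \<and> last vs = t \<and>
     set vs \<subseteq> verts G \<and> set es \<subseteq> edges G \<and>
     (\<forall>i < length es. ends G (es ! i) = {vs ! i, vs ! Suc i})"

definition is_path :: "('v, 'e) mgraph \<Rightarrow> 'v \<Rightarrow> 'v \<Rightarrow> 'v list \<Rightarrow> 'e list \<Rightarrow> bool" where
  "is_path G s t vs es \<longleftrightarrow> is_walk G s t vs es \<and> distinct vs"

definition st_walks :: "('v, 'e) mgraph \<Rightarrow> 'v \<Rightarrow> 'v \<Rightarrow> 'e multiset set" where
  "st_walks G s t = {mset es | vs es. is_walk G s t vs es}"

definition st_paths :: "('v, 'e) mgraph \<Rightarrow> 'v \<Rightarrow> 'v \<Rightarrow> 'e multiset set" where
  "st_paths G s t = {mset es | vs es. is_path G s t vs es}"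

definition sp_instance :: "('v, 'e) mgraph \<Rightarrow> 'v \<Rightarrow> 'v \<Rightarrow> bool" where
  "sp_instance G s t \<longleftrightarrow>
     multigraph G \<and> s \<in> verts G \<and> t \<in> verts G \<and> st_paths G s t \<noteq> {}"

text \<open>
  Weight vectors are extensional functions, so that distinct weight vectors differ on an edge and
  hence have positive distance.
\<close>

definition weights :: "('v, 'e) mgraph \<Rightarrow> ('e \<Rightarrow> real) set" where
  "weights G = edges G \<rightarrow>\<^sub>E {0..}"

definition walk_length :: "('e \<Rightarrow> real) \<Rightarrow> 'e multiset \<Rightarrow> real" where
  "walk_length w P = (\<Sum>e\<in>#P. w e)"

definition opt_length :: "('v, 'e) mgraph \<Rightarrow> 'v \<Rightarrow> 'v \<Rightarrow> ('e \<Rightarrow> real) \<Rightarrow> real" where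
  "opt_length G s t w = Min (walk_length w ` st_paths G s t)"

text \<open>
  A randomized algorithm is identified with its output distributions. There are only countably many
  multisets over a finite edge set, so discrete distributions lose no generality.
\<close>

type_synonym ('v, 'e) sp_algorithm =
  "('v, 'e) mgraph \<Rightarrow> 'v \<Rightarrow> 'v \<Rightarrow> ('e \<Rightarrow> real) \<Rightarrow> 'e multiset pmf"

definition approximation_algorithm :: "real \<Rightarrow> ('v, 'e) sp_algorithm \<Rightarrow> bool" where
  "approximation_algorithm \<alpha> A \<longleftrightarrow>
     (\<forall>G s t w. sp_instance G s t \<and> w \<in> weights G \<longrightarrow>
        set_pmf (A G s t w) \<subseteq> st_walks G s t \<and>
        (\<integral>\<^sup>+ P. ennreal (walk_length w P) \<partial>measure_pmf (A G s t w))
          \<le> ennreal (\<alpha> * opt_length G s t w))"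

definition l1_dist :: "('v, 'e) mgraph \<Rightarrow> ('e \<Rightarrow> real) \<Rightarrow> ('e \<Rightarrow> real) \<Rightarrow> real" where
  "l1_dist G x y = (\<Sum>e\<in>edges G. \<bar>x e - y e\<bar>)"

definition weight_vector :: "'e multiset \<Rightarrow> ('e \<Rightarrow> real) \<Rightarrow> 'e \<Rightarrow> real" where
  "weight_vector P w = (\<lambda>f. \<Sum>e\<in>#P. w e * indicator {e} f)"

definition d_w ::
  "('v, 'e) mgraph \<Rightarrow> 'e multiset \<times> ('e \<Rightarrow> real) \<Rightarrow> 'e multiset \<times> ('e \<Rightarrow> real) \<Rightarrow> real" where
  "d_w G = (\<lambda>(P, w) (P', w'). l1_dist G (weight_vector P w) (weight_vector P' w'))"

definition couplings :: "'a pmf \<Rightarrow> 'b pmf \<Rightarrow> ('a \<times> 'b) pmf set" where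
  "couplings \<mu> \<nu> = {\<pi>. map_pmf fst \<pi> = \<mu> \<and> map_pmf snd \<pi> = \<nu>}"

definition EM_w ::
  "('v, 'e) mgraph \<Rightarrow> 'e multiset pmf \<times> ('e \<Rightarrow> real) \<Rightarrow> 'e multiset pmf \<times> ('e \<Rightarrow> real) \<Rightarrow> ennreal"
  where
  "EM_w G = (\<lambda>(\<mu>, w) (\<nu>, w').
     INF \<pi>\<in>couplings \<mu> \<nu>. \<integral>\<^sup>+ (P, P'). ennreal (d_w G (P, w) (P', w')) \<partial>measure_pmf \<pi>)"

definition lipschitz_constant ::
  "('v, 'e) sp_algorithm \<Rightarrow> ('v, 'e) mgraph \<Rightarrow> 'v \<Rightarrow> 'v \<Rightarrow> ennreal" where
  "lipschitz_constant A G s t =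
     (SUP (w, w') \<in> {(w, w'). w \<in> weights G \<and> w' \<in> weights G \<and> w \<noteq> w'}.
        EM_w G (A G s t w, w) (A G s t w', w') / ennreal (l1_dist G w w'))"

end

theory Submission
  imports Defs
begin

text \<open>
  Take two parallel edges between \<open>s\<close> and \<open>t\<close>, one of weight 1 and one of weight
  \<open>1 + 4\<epsilon>\<close>. Every walk has length at least 1, so the excess of the expected length over 1 is at
  most \<open>\<epsilon>\<close>, and by Markov's inequality the heavy edge is used with probability at most 1/4.
  Now exchange the two weights, a move of length \<open>8\<epsilon>\<close>. In any coupling of the two outputs,
  with probability at least 1/2 both walks use only their own light edge, so they are at
  distance at least 2. Hence the earth mover's distance is at least 1.
\<close>

text \<open>The labels 0 and 1 name both the two vertices and the two edges. Restricting
  \<open>ends\<close> to the edges meets the extensionality demanded by \<open>multigraph\<close>;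
  \<open>pair_weights\<close> is restricted likewise for \<open>weights\<close>.\<close>

definition parallel_pair :: "(nat, nat) mgraph" where
  "parallel_pair = \<lparr>verts = {0, 1}, edges = {0, 1}, ends = (\<lambda>e\<in>{0, 1}. {0, 1})\<rparr>"

definition pair_weights :: "real \<Rightarrow> real \<Rightarrow> nat \<Rightarrow> real" where
  "pair_weights a b = (\<lambda>e\<in>{0, 1}. if e = 0 then a else b)"

lemma pair_weights_simps [simp]:
  "pair_weights a b 0 = a" "pair_weights a b (Suc 0) = b"
  by (simp_all add: pair_weights_def)

lemma pair_weights_in_weights:
  "0 \<le> a \<Longrightarrow> 0 \<le> b \<Longrightarrow> pair_weights a b \<in> weights parallel_pair"
  by (auto simp: pair_weights_def weights_def parallel_pair_def)

text \<open>This closed form lets \<open>d_w\<close> be evaluated edge by edge.\<close>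

lemma weight_vector_eq_count: "weight_vector P w f = real (count P f) * w f"
  by (induction P) (auto simp: weight_vector_def algebra_simps)

lemma walk_length_nonneg:
  assumes "\<And>e. e \<in># P \<Longrightarrow> 0 \<le> w e"
  shows "0 \<le> walk_length w P"
  using assms by (induction P) (auto simp: walk_length_def)

lemma weight_le_walk_length:
  assumes "e \<in># P" "\<And>e. e \<in># P \<Longrightarrow> 0 \<le> w e"
  shows "w e \<le> walk_length w P"
proof -
  obtain Q where Q: "P = add_mset e Q"
    using assms(1) by (metis mset_add)
  then have "0 \<le> walk_length w Q"
    using assms(2) by (intro walk_length_nonneg) auto
  then show ?thesis
    by (simp add: Q walk_length_def)
qed

lemma single_in_st_paths:
  assumes "e \<in> {0, 1}"
  shows "{#e#} \<in> st_paths parallel_pair 0 1"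
proof -
  have "is_path parallel_pair 0 1 [0, 1] [e]"
    using assms by (auto simp: is_path_def is_walk_def parallel_pair_def)
  then show ?thesis
    unfolding st_paths_def by (metis (mono_tags, lifting) mem_Collect_eq mset_single_iff)
qed

text \<open>A walk without edges has a single vertex, which would have to be both 0 and 1.\<close>

lemma st_walks_parallel_pair:
  assumes "P \<in> st_walks parallel_pair 0 1"
  shows "P \<noteq> {#}" "set_mset P \<subseteq> {0, 1}"
proof -
  obtain vs es where "P = mset es" and walk: "is_walk parallel_pair 0 1 vs es"
    using assms by (auto simp: st_walks_def)
  moreover have "es \<noteq> []"
  proof
    assume "es = []"
    then obtain v where "vs = [v]"
      using walk by (auto simp: is_walk_def length_Suc_conv)
    then show False
      using walk by (auto simp: is_walk_def)
  qed
  ultimately show "P \<noteq> {#}" "set_mset P \<subseteq> {0, 1}"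
    by (auto simp: is_walk_def parallel_pair_def)
qed

text \<open>Distinct vertices among only two allow at most one edge, and a walk from 0 to 1 has at
  least one. The explicit set makes the \<open>Min\<close> in \<open>opt_length\<close>
  computable.\<close>

lemma st_paths_parallel_pair: "st_paths parallel_pair 0 1 = {{#0#}, {#1#}}"
proof
  show "st_paths parallel_pair 0 1 \<subseteq> {{#0#}, {#1#}}"
  proof
    fix P assume "P \<in> st_paths parallel_pair 0 1"
    then obtain vs es where P: "P = mset es" and walk: "is_walk parallel_pair 0 1 vs es"
      and "distinct vs"
      by (auto simp: st_paths_def is_path_def)
    have "P \<in> st_walks parallel_pair 0 1"
      using P walk by (auto simp: st_walks_def)
    note * = st_walks_parallel_pair[OF this]
    have "set vs \<subseteq> {0, 1}"
      using walk by (auto simp: is_walk_def parallel_pair_def)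
    then have "length vs \<le> 2"
      using card_mono[of "{0, 1}" "set vs"] \<open>distinct vs\<close> by (simp add: distinct_card)
    then have "length es = 1"
      using walk P * by (cases es) (auto simp: is_walk_def)
    then obtain e where "es = [e]"
      by (auto simp: length_Suc_conv)
    then show "P \<in> {{#0#}, {#1#}}"
      using P * by auto
  qed
qed (use single_in_st_paths in auto)

lemma sp_instance_parallel_pair: "sp_instance parallel_pair 0 1"
proof -
  have "{0, 1} \<in> {{u, v} | u v. u \<in> {0, 1::nat} \<and> v \<in> {0, 1} \<and> u \<noteq> v}"
    by force
  then have "multigraph parallel_pair"
    by (auto simp: multigraph_def parallel_pair_def)
  then show ?thesis
    unfolding sp_instance_def st_paths_parallel_pair by (simp add: parallel_pair_def)
qed

lemma opt_length_parallel_pair: "opt_length parallel_pair 0 1 (pair_weights a b) = min a b"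
  unfolding opt_length_def st_paths_parallel_pair by (simp add: walk_length_def)

text \<open>Markov's inequality for X - 1: on the support, X dominates 1 + \<delta> times the
  indicator of B, and integrating this bounds the mean from below.\<close>

lemma pmf_prob_excess_le:
  fixes X :: "'a \<Rightarrow> real"
  assumes "0 < \<delta>" "0 \<le> \<epsilon>"
    and low: "\<And>x. x \<in> set_pmf p \<Longrightarrow> 1 \<le> X x"
    and high: "\<And>x. x \<in> set_pmf p \<Longrightarrow> x \<in> B \<Longrightarrow> 1 + \<delta> \<le> X x"
    and mean: "(\<integral>\<^sup>+ x. ennreal (X x) \<partial>measure_pmf p) \<le> ennreal (1 + \<epsilon>)"
  shows "measure_pmf.prob p B \<le> \<epsilon> / \<delta>"
proof -
  have "ennreal (1 + \<delta> * measure_pmf.prob p B) = 1 + ennreal \<delta> * emeasure (measure_pmf p) B"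
    using \<open>0 < \<delta>\<close> by (simp add: measure_pmf.emeasure_eq_measure ennreal_mult)
  also have "\<dots> = (\<integral>\<^sup>+ x. 1 + ennreal \<delta> * indicator B x \<partial>measure_pmf p)"
    by (simp add: nn_integral_add nn_integral_cmult)
  also have "\<dots> \<le> (\<integral>\<^sup>+ x. ennreal (X x) \<partial>measure_pmf p)"
  proof (intro nn_integral_mono_AE AE_pmfI)
    fix x assume x: "x \<in> set_pmf p"
    have "1 + ennreal \<delta> * indicator B x = ennreal (1 + \<delta> * indicator B x)"
      using \<open>0 < \<delta>\<close> by (auto simp: indicator_def)
    also have "\<dots> \<le> ennreal (X x)"
      using low[OF x] high[OF x] by (intro ennreal_leI) (auto simp: indicator_def)
    finally show "1 + ennreal \<delta> * indicator B x \<le> ennreal (X x)" .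
  qed
  also note mean
  \<comment> \<open>With each side kept as \<open>ennreal\<close> of a single real, the inequality
    passes to the reals, where the 1 cancels.\<close>
  finally have "\<delta> * measure_pmf.prob p B \<le> \<epsilon>"
    using \<open>0 \<le> \<epsilon>\<close> by (simp del: ennreal_plus)
  then show ?thesis
    using \<open>0 < \<delta>\<close> by (simp add: field_simps)
qed

text \<open>Here \<open>h\<close> is the heavy edge; the disjunction covers both orders of the
  weights at once.\<close>

lemma heavy_edge_prob:
  fixes A :: "(nat, nat) sp_algorithm"
  assumes "0 < \<epsilon>" "approximation_algorithm (1 + \<epsilon>) A"
    and w: "w = pair_weights 1 (1 + 4 * \<epsilon>) \<and> h = 1 \<or> w = pair_weights (1 + 4 * \<epsilon>) 1 \<and> h = 0"
  shows "set_pmf (A parallel_pair 0 1 w) \<subseteq> st_walks parallel_pair 0 1"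
    and "measure_pmf.prob (A parallel_pair 0 1 w) {P. h \<in># P} \<le> 1 / 4"
proof -
  have "w \<in> weights parallel_pair"
    using w \<open>0 < \<epsilon>\<close> by (auto intro!: pair_weights_in_weights)
  then have walks: "set_pmf (A parallel_pair 0 1 w) \<subseteq> st_walks parallel_pair 0 1"
    and mean: "(\<integral>\<^sup>+ P. ennreal (walk_length w P) \<partial>measure_pmf (A parallel_pair 0 1 w))
      \<le> ennreal ((1 + \<epsilon>) * opt_length parallel_pair 0 1 w)"
    using assms(2) sp_instance_parallel_pair unfolding approximation_algorithm_def by blast+
  show "set_pmf (A parallel_pair 0 1 w) \<subseteq> st_walks parallel_pair 0 1"
    by fact
  have opt: "opt_length parallel_pair 0 1 w = 1"
    using w \<open>0 < \<epsilon>\<close> by (auto simp: opt_length_parallel_pair simp del: One_nat_def)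
  have wge: "1 \<le> w e" if "e \<in> {0, 1}" for e
    using that w \<open>0 < \<epsilon>\<close> by auto
  have len: "w e \<le> walk_length w P"
    if "P \<in> set_pmf (A parallel_pair 0 1 w)" "e \<in># P" for P e
  proof (rule weight_le_walk_length[OF that(2)])
    fix e' assume "e' \<in># P"
    then have "e' \<in> {0, 1}"
      using that(1) walks st_walks_parallel_pair(2) by blast
    then show "0 \<le> w e'"
      using wge[of e'] by simp
  qed
  \<comment> \<open>Using \<open>h\<close> costs an excess of 4\<epsilon> over the optimum 1, while
    the mean excess is at most \<epsilon>.\<close>
  have "measure_pmf.prob (A parallel_pair 0 1 w) {P. h \<in># P} \<le> \<epsilon> / (4 * \<epsilon>)"
  proof (rule pmf_prob_excess_le[where X = "walk_length w"])
    fix P assume P: "P \<in> set_pmf (A parallel_pair 0 1 w)"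
    then have "P \<noteq> {#}" "set_mset P \<subseteq> {0, 1}"
      using walks st_walks_parallel_pair by blast+
    then obtain e where "e \<in># P" "e \<in> {0, 1}"
      by blast
    then show "1 \<le> walk_length w P"
      using len[OF P, of e] wge[of e] by linarith
    show "1 + 4 * \<epsilon> \<le> walk_length w P" if "P \<in> {P. h \<in># P}"
      using len[OF P, of h] that w by auto
  qed (use \<open>0 < \<epsilon>\<close> mean opt in auto)
  then show "measure_pmf.prob (A parallel_pair 0 1 w) {P. h \<in># P} \<le> 1 / 4"
    using \<open>0 < \<epsilon>\<close> by simp
qed

text \<open>Each walk is nonempty and avoids its heavy edge, so it consists of copies of its light
  edge, of weight 1. The two light edges differ, so the contributions add up without
  cancelling.\<close>

lemma d_w_light_walks_ge:
  assumes P: "P \<in> st_walks parallel_pair 0 1" "1 \<notin># P"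
    and P': "P' \<in> st_walks parallel_pair 0 1" "0 \<notin># P'"
  shows "2 \<le> d_w parallel_pair (P, pair_weights 1 a) (P', pair_weights b 1)"
proof -
  have "0 \<in># P"
    using st_walks_parallel_pair[OF P(1)] P(2) by (metis insertE multiset_nonemptyE singletonD subsetD)
  moreover have "1 \<in># P'"
    using st_walks_parallel_pair[OF P'(1)] P'(2) by (metis insertE multiset_nonemptyE singletonD subsetD)
  ultimately have "1 \<le> real (count P 0)" "1 \<le> real (count P' 1)" "count P 1 = 0" "count P' 0 = 0"
    using P(2) P'(2) by (auto simp: not_in_iff Suc_le_eq)
  moreover from this have "d_w parallel_pair (P, pair_weights 1 a) (P', pair_weights b 1)
      = real (count P 0) + real (count P' 1)"
    by (simp add: d_w_def l1_dist_def weight_vector_eq_count parallel_pair_def)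
  ultimately show ?thesis
    by linarith
qed

text \<open>A union bound over the two bad events, whose probabilities under any coupling are fixed
  by the marginals.\<close>

lemma coupling_both_good_prob:
  assumes "\<pi> \<in> couplings \<mu> \<nu>"
  shows "1 - measure_pmf.prob \<mu> B - measure_pmf.prob \<nu> C
    \<le> measure_pmf.prob \<pi> {(x, y). x \<notin> B \<and> y \<notin> C}"
proof -
  have *: "measure_pmf.prob \<mu> B = measure_pmf.prob \<pi> (fst -` B)"
    "measure_pmf.prob \<nu> C = measure_pmf.prob \<pi> (snd -` C)"
    using assms by (auto simp: couplings_def)
  have "{(x, y). x \<notin> B \<and> y \<notin> C} = UNIV - (fst -` B \<union> snd -` C)"
    by auto
  then have "measure_pmf.prob \<pi> {(x, y). x \<notin> B \<and> y \<notin> C}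
      = 1 - measure_pmf.prob \<pi> (fst -` B \<union> snd -` C)"
    using measure_pmf.prob_compl[of "fst -` B \<union> snd -` C" \<pi>] by simp
  moreover have "measure_pmf.prob \<pi> (fst -` B \<union> snd -` C)
      \<le> measure_pmf.prob \<pi> (fst -` B) + measure_pmf.prob \<pi> (snd -` C)"
    by (rule measure_Un_le) auto
  ultimately show ?thesis
    using * by linarith
qed

lemma EM_w_swapped_weights_ge:
  fixes A :: "(nat, nat) sp_algorithm"
  assumes "0 < \<epsilon>" "approximation_algorithm (1 + \<epsilon>) A"
  defines "w \<equiv> pair_weights 1 (1 + 4 * \<epsilon>)" and "w' \<equiv> pair_weights (1 + 4 * \<epsilon>) 1"
  shows "1 \<le> EM_w parallel_pair (A parallel_pair 0 1 w, w) (A parallel_pair 0 1 w', w')"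
proof -
  let ?\<mu> = "A parallel_pair 0 1 w" and ?\<nu> = "A parallel_pair 0 1 w'"
  have \<mu>: "set_pmf ?\<mu> \<subseteq> st_walks parallel_pair 0 1" "measure_pmf.prob ?\<mu> {P. 1 \<in># P} \<le> 1 / 4"
    using heavy_edge_prob[OF assms(1,2), of w 1] by (simp_all add: w_def)
  have \<nu>: "set_pmf ?\<nu> \<subseteq> st_walks parallel_pair 0 1" "measure_pmf.prob ?\<nu> {P. 0 \<in># P} \<le> 1 / 4"
    using heavy_edge_prob[OF assms(1,2), of w' 0] by (simp_all add: w'_def)
  have "1 \<le> (\<integral>\<^sup>+ (P, P'). ennreal (d_w parallel_pair (P, w) (P', w')) \<partial>measure_pmf \<pi>)"
    if \<pi>: "\<pi> \<in> couplings ?\<mu> ?\<nu>" for \<pi>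
  proof -
    let ?S = "{(P, P'). P \<notin> {P. 1 \<in># P} \<and> P' \<notin> {P. 0 \<in># P}} :: (nat multiset \<times> nat multiset) set"
    \<comment> \<open>\<open>?S\<close> is the event that both walks avoid their heavy edge; 1 - 1/4
      - 1/4 = 1/2.\<close>
    have "1 / 2 \<le> measure_pmf.prob \<pi> ?S"
      using coupling_both_good_prob[OF \<pi>, of "{P. 1 \<in># P}" "{P. 0 \<in># P}"] \<mu>(2) \<nu>(2) by linarith
    then have "1 \<le> ennreal (2 * measure_pmf.prob \<pi> ?S)"
      by simp
    also have "\<dots> = (\<integral>\<^sup>+ z. 2 * indicator ?S z \<partial>measure_pmf \<pi>)"
      by (simp add: nn_integral_cmult measure_pmf.emeasure_eq_measure ennreal_mult)
    also have "\<dots> \<le> (\<integral>\<^sup>+ (P, P'). ennreal (d_w parallel_pair (P, w) (P', w')) \<partial>measure_pmf \<pi>)"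
    proof (intro nn_integral_mono_AE AE_pmfI)
      fix z assume z: "z \<in> set_pmf \<pi>"
      obtain P P' where zP: "z = (P, P')"
        by (cases z)
      \<comment> \<open>The support of \<pi> projects into the supports of the marginals, so both
        components are walks from 0 to 1.\<close>
      have "?\<mu> = map_pmf fst \<pi>" "?\<nu> = map_pmf snd \<pi>"
        using \<pi> by (auto simp: couplings_def)
      then have "P \<in> set_pmf ?\<mu>" "P' \<in> set_pmf ?\<nu>"
        using z zP by force+
      then have "P \<in> st_walks parallel_pair 0 1" "P' \<in> st_walks parallel_pair 0 1"
        using \<mu>(1) \<nu>(1) by auto
      then have "2 \<le> d_w parallel_pair (P, w) (P', w')" if "1 \<notin># P" "0 \<notin># P'"
        using that d_w_light_walks_ge unfolding w_def w'_def by blast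
      then have "2 \<le> ennreal (d_w parallel_pair (P, w) (P', w'))" if "1 \<notin># P" "0 \<notin># P'"
        using that ennreal_leI[of 2] by fastforce
      then show "2 * indicator ?S z \<le> (case z of (P, P') \<Rightarrow> ennreal (d_w parallel_pair (P, w) (P', w')))"
        by (auto simp: zP indicator_def)
    qed
    finally show ?thesis .
  qed
  then show ?thesis
    unfolding EM_w_def by (auto intro!: INF_greatest)
qed

theorem theorem6p2:
  shows "\<exists>c::real. c > 0 \<and>
    (\<forall>(\<epsilon>::real) (A::(nat, nat) sp_algorithm).
       \<epsilon> > 0 \<and> approximation_algorithm (1 + \<epsilon>) A \<longrightarrow>
       (\<exists>G s t. sp_instance G s t \<and> lipschitz_constant A G s t \<ge> ennreal (c / \<epsilon>)))"
\<comment> \<open>The constant is the quotient of the earth mover's bound 1 by the weight distance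
  8\<epsilon>, without the factor 1/\<epsilon>.\<close>
proof (intro exI[of _ "1 / 8"] conjI allI impI)
  fix \<epsilon> :: real and A :: "(nat, nat) sp_algorithm"
  assume "\<epsilon> > 0 \<and> approximation_algorithm (1 + \<epsilon>) A"
  then have "0 < \<epsilon>" and A: "approximation_algorithm (1 + \<epsilon>) A"
    by auto
  define w where "w = pair_weights 1 (1 + 4 * \<epsilon>)"
  define w' where "w' = pair_weights (1 + 4 * \<epsilon>) 1"
  have "w \<in> weights parallel_pair" "w' \<in> weights parallel_pair"
    using \<open>0 < \<epsilon>\<close> by (auto simp: w_def w'_def intro!: pair_weights_in_weights)
  \<comment> \<open>The supremum ranges over distinct weight vectors only; edge 0 tells these two
    apart.\<close>
  moreover have "w 0 \<noteq> w' 0"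
    using \<open>0 < \<epsilon>\<close> by (simp add: w_def w'_def)
  ultimately have ww': "(w, w') \<in> {(w, w'). w \<in> weights parallel_pair \<and> w' \<in> weights parallel_pair \<and> w \<noteq> w'}"
    by auto
  \<comment> \<open>Each of the two edges changes its weight by 4\<epsilon>.\<close>
  have dist: "l1_dist parallel_pair w w' = 8 * \<epsilon>"
    using \<open>0 < \<epsilon>\<close> by (simp add: l1_dist_def parallel_pair_def w_def w'_def)
  have "ennreal (1 / 8 / \<epsilon>) = 1 / ennreal (l1_dist parallel_pair w w')"
    using \<open>0 < \<epsilon>\<close> divide_ennreal[of 1 "8 * \<epsilon>"] by (simp add: dist)
  also have "\<dots> \<le> EM_w parallel_pair (A parallel_pair 0 1 w, w) (A parallel_pair 0 1 w', w')
      / ennreal (l1_dist parallel_pair w w')"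
    using EM_w_swapped_weights_ge[OF \<open>0 < \<epsilon>\<close> A] unfolding w_def w'_def
    by (rule divide_right_mono_ennreal)
  also have "\<dots> \<le> lipschitz_constant A parallel_pair 0 1"
    unfolding lipschitz_constant_def by (rule SUP_upper2[OF ww']) simp
  finally show "\<exists>G s t. sp_instance G s t \<and> lipschitz_constant A G s t \<ge> ennreal (1 / 8 / \<epsilon>)"
    using sp_instance_parallel_pair by blast
qed simp

end
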